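(* Let $\mathfrak{g}=\mathrm{Witt}$ or $\mathfrak{g}=\mathrm{Vir}$. The set $$\{\rho\in\mathrm{Hom}_{\text{Lie-alg}}(\mathfrak{g},\mathrm{Diff}(\mathbb{C}[[z]])):\rho(L_0)\text{ is of first order}\}$$ is in bijection with the triples $(h(z),b(z),c)\in\mathcal{T}_1$ where $h(z),b(z)\in\mathbb{C}[[z]]$ and $h'(z)\in\mathbb{C}[[z]]^*$, through the expression $$\rho(L_i)=\frac{-h(z)^{i+1}}{h'(z)}\partial+(b(z)+i\cdot c)\cdot h(z)^i\qquad\forall L_i\in\mathfrak{g}.$$
   Context: $\mathrm{Witt}$ is the complex Lie algebra with basis $\{L_i\}_{i\in\mathbb{Z}}$ and $[L_i,L_j]=(i-j)L_{i+j}$. $\mathrm{Vir}$ is its central extension by a central element $K$ with $[L_i,L_j]=(i-j)L_{i+j}+\frac1{12}(i^3-i)\delta_{i+j,0}K$; in the case of $\mathrm{Vir}$ the representation given by the displayed expression sends $K$ to $0$. $\mathrm{Diff}(\mathbb{C}[[z]])$ is the Lie algebra (under commutator) of finite sums $\sum_{j=0}^k\xi_j\partial^j$ with $\xi_j\in\mathbb{C}[[z]]$, $\partial=\frac{\partial}{\partial z}$; the order is $k$ if $\xi_k\neq0$; "first order" means order exactly $1$. $\mathcal{T}_1$ is the set of triples $(h(z),b(z),c)$ with $h(z),b(z)\in\mathbb{C}((z))$, $h'(z)\neq0$ and $c\in\mathbb{C}$. $h'=\partial h$, and $\mathbb{C}[[z]]^*$ is the group of invertible power series.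
   Formalization: The triples are additionally required to have h(z) invertible in C[[z]]; without this the claim fails, e.g. (h,b,c) = (z,0,0) gives ρ(L_{-2}) = -z^{-1}∂, which is not in Diff(C[[z]]). *)

theory Defs
  imports
    "HOL-Library.Poly_Mapping"
    "HOL-Computational_Algebra.Formal_Laurent_Series"
begin

section \<open>Complex Lie algebras given by a basis and structure constants\<close>

text \<open>
  The complex vector space with basis \<open>'g\<close> is \<^typ>\<open>'g \<Rightarrow>\<^sub>0 complex\<close>, the finitely supported functions.
  A bracket is given by its values on pairs of basis vectors and extended bilinearly.
\<close>

definition scale_vec :: "complex \<Rightarrow> ('g \<Rightarrow>\<^sub>0 complex) \<Rightarrow> ('g \<Rightarrow>\<^sub>0 complex)"
  where "scale_vec a x = Poly_Mapping.map ((*) a) x"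

definition basis_vec :: "'g \<Rightarrow> ('g \<Rightarrow>\<^sub>0 complex)"
  where "basis_vec g = Poly_Mapping.single g 1"

definition bilinear_ext ::
    "('g \<Rightarrow> 'g \<Rightarrow> ('g \<Rightarrow>\<^sub>0 complex)) \<Rightarrow> ('g \<Rightarrow>\<^sub>0 complex) \<Rightarrow> ('g \<Rightarrow>\<^sub>0 complex) \<Rightarrow> ('g \<Rightarrow>\<^sub>0 complex)"
  where "bilinear_ext br x y =
    (\<Sum>g\<in>Poly_Mapping.keys x. \<Sum>g'\<in>Poly_Mapping.keys y.
       scale_vec (Poly_Mapping.lookup x g * Poly_Mapping.lookup y g') (br g g'))"

lemma scale_vec_1 [simp]: "scale_vec 1 x = x"
  unfolding scale_vec_def by (rule poly_mapping_eqI) (simp add: Poly_Mapping.map.rep_eq when_def)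

lemma bilinear_ext_basis [simp]: "bilinear_ext br (basis_vec g) (basis_vec g') = br g g'"
  by (simp add: bilinear_ext_def basis_vec_def)

text \<open>The basis vector \<open>L\<^sub>i\<close> of the Witt algebra is \<open>basis_vec i\<close>.\<close>

type_synonym witt = "int \<Rightarrow>\<^sub>0 complex"

definition witt_bracket :: "witt \<Rightarrow> witt \<Rightarrow> witt"
  where "witt_bracket =
    bilinear_ext (\<lambda>i j. scale_vec (of_int (i - j)) (basis_vec (i + j)))"

datatype vir_basis = L int | K

type_synonym vir = "vir_basis \<Rightarrow>\<^sub>0 complex"

fun vir_bracket_basis :: "vir_basis \<Rightarrow> vir_basis \<Rightarrow> vir" where
  "vir_bracket_basis (L i) (L j) =
     scale_vec (of_int (i - j)) (basis_vec (L (i + j)))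
     + scale_vec (if i + j = 0 then of_int (i ^ 3 - i) / 12 else 0) (basis_vec K)"
| "vir_bracket_basis K _ = 0"
| "vir_bracket_basis _ K = 0"

definition vir_bracket :: "vir \<Rightarrow> vir \<Rightarrow> vir"
  where "vir_bracket = bilinear_ext vir_bracket_basis"


section \<open>Differential operators with coefficients in the formal power series\<close>

text \<open>
  Differential operators are represented by their action on \<open>\<complex>[[z]]\<close>.  Over \<open>\<complex>\<close> this action is
  faithful, i.e. the coefficients \<open>\<xi> 0, \<dots>, \<xi> k\<close> are determined by the operator, so that the
  order is well defined.
\<close>

type_synonym fps_op = "complex fps \<Rightarrow> complex fps"

definition diff_op :: "nat \<Rightarrow> (nat \<Rightarrow> complex fps) \<Rightarrow> fps_op"
  where "diff_op k \<xi> = (\<lambda>f. \<Sum>j\<le>k. \<xi> j * (fps_deriv ^^ j) f)"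

definition Diff :: "fps_op set"
  where "Diff = {D. \<exists>k \<xi>. D = diff_op k \<xi>}"

definition has_order :: "fps_op \<Rightarrow> nat \<Rightarrow> bool"
  where "has_order D k \<longleftrightarrow> (\<exists>\<xi>. \<xi> k \<noteq> 0 \<and> D = diff_op k \<xi>)"

definition commutator :: "fps_op \<Rightarrow> fps_op \<Rightarrow> fps_op"
  where "commutator D E = (\<lambda>f. D (E f) - E (D f))"

definition lie_homs_Diff ::
    "(('g \<Rightarrow>\<^sub>0 complex) \<Rightarrow> ('g \<Rightarrow>\<^sub>0 complex) \<Rightarrow> ('g \<Rightarrow>\<^sub>0 complex)) \<Rightarrow> (('g \<Rightarrow>\<^sub>0 complex) \<Rightarrow> fps_op) set"
  where "lie_homs_Diff bracket =
    {\<rho>. (\<forall>x. \<rho> x \<in> Diff)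
       \<and> (\<forall>x y f. \<rho> (x + y) f = \<rho> x f + \<rho> y f)
       \<and> (\<forall>a x f. \<rho> (scale_vec a x) f = fps_const a * \<rho> x f)
       \<and> (\<forall>x y. \<rho> (bracket x y) = commutator (\<rho> x) (\<rho> y))}"


section \<open>The parameter triples\<close>

definition T1 :: "(complex fls \<times> complex fls \<times> complex) set"
  where "T1 = {(h, b, c). fls_deriv h \<noteq> 0}"

text \<open>\<open>\<complex>[[z]]\<close> and its group of units \<open>\<complex>[[z]]\<^sup>*\<close> inside \<open>\<complex>((z))\<close>:\<close>

definition power_series :: "complex fls set"
  where "power_series = range fps_to_fls"

definition unit_power_series :: "complex fls set"
  where "unit_power_series = fps_to_fls ` {u. u dvd 1}"

text \<open>
  \<open>L_expr h b c i\<close> is the operator \<open>-h\<^sup>i\<^sup>+\<^sup>1/h' \<partial> + (b + i c) h\<^sup>i\<close>, whose coefficients are a priori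
  Laurent series, applied to power series.
\<close>

definition L_expr ::
    "complex fls \<Rightarrow> complex fls \<Rightarrow> complex \<Rightarrow> int \<Rightarrow> complex fps \<Rightarrow> complex fls"
  where "L_expr h b c i f =
    - (h powi (i + 1)) / fls_deriv h * fls_deriv (fps_to_fls f)
    + (b + fls_const (of_int i * c)) * h powi i * fps_to_fls f"

text \<open>
  The expression involves all integer powers of \<open>h\<close>.  Besides the conditions on \<open>h'\<close> and \<open>b\<close>,
  it therefore defines operators on \<open>\<complex>[[z]]\<close> for all \<open>i\<close> only if \<open>h\<close> itself is invertible in
  \<open>\<complex>[[z]]\<close>; this is proved in \<open>unit_if_L_expr_preserves_fps\<close> below.  For instance, \<open>h = z\<close>
  would give \<open>\<rho>(L\<^sub>-\<^sub>2) = -z\<^sup>-\<^sup>1\<partial> + \<dots>\<close>.  The invertibility of \<open>h\<close> is part of the definition.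
\<close>

definition triples :: "(complex fls \<times> complex fls \<times> complex) set"
  where "triples =
    {(h, b, c) \<in> T1. h \<in> power_series \<and> b \<in> power_series
       \<and> fls_deriv h \<in> unit_power_series \<and> h \<in> unit_power_series}"

lemma unit_if_L_expr_preserves_fps:
  assumes h: "h \<in> power_series" and h': "fls_deriv h \<in> unit_power_series"
    and L: "\<And>f. L_expr h b c (-2) f \<in> power_series"
  shows "h \<in> unit_power_series"
proof -
  obtain u where u: "h = fps_to_fls u" using h by (auto simp: power_series_def)
  obtain v where v: "fls_deriv h = fps_to_fls v" "v dvd 1"
    using h' by (auto simp: unit_power_series_def)
  have v0: "v \<noteq> 0" using v(2) by auto
  hence h0: "h \<noteq> 0" using v(1) by auto
  obtain p where p: "L_expr h b c (-2) 1 = fps_to_fls p"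
    using L[of 1] by (auto simp: power_series_def)
  obtain q where q: "L_expr h b c (-2) fps_X = fps_to_fls q"
    using L[of fps_X] by (auto simp: power_series_def)
  have "L_expr h b c (-2) fps_X - fps_to_fls fps_X * L_expr h b c (-2) 1
      = - inverse h / fls_deriv h"
    by (simp add: L_expr_def fls_deriv_fps_to_fls power_int_minus)
  hence "- inverse h / fls_deriv h = fps_to_fls (q - fps_X * p)"
    by (simp add: p q fls_times_fps_to_fls)
  hence "1 = h * fls_deriv h * fps_to_fls (- (q - fps_X * p))"
    using h0 v v0 by (simp add: field_simps)
  hence "fps_to_fls 1 = fps_to_fls (u * (v * (- (q - fps_X * p))))"
    by (simp only: u[symmetric] v(1) fls_times_fps_to_fls fps_one_to_fls mult.assoc)
  hence "1 = u * (v * (- (q - fps_X * p)))" by (simp only: fps_to_fls_eq_iff)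
  hence "u dvd 1" by (metis dvd_triv_left)
  thus ?thesis using u by (auto simp: unit_power_series_def)
qed

end

theory Submission
  imports Defs
begin

text \<open>
  Write \<open>D\<^sub>i\<close> for the image of \<open>L\<^sub>i\<close>.  Everything rests on the top coefficients of the \<open>D\<^sub>i\<close>.

  If \<open>p \<partial>\<^sup>k\<close> and \<open>q \<partial>\<^sup>l\<close> are the leading terms of two operators, then their commutator has order at
  most \<open>k + l - 1\<close>, with coefficient \<open>k p q' - l q p'\<close> there (\<open>op_comm_top\<close>).  Let
  \<open>D\<^sub>0 = a \<partial> + b\<close> with \<open>a \<noteq> 0\<close>, and let \<open>\<xi>\<^sub>i\<close> be the leading coefficient of \<open>D\<^sub>i\<close> and \<open>k\<^sub>i\<close> its order.
  The relation between \<open>L\<^sub>0\<close> and \<open>L\<^sub>i\<close> gives the equation \<open>a \<xi>\<^sub>i' = (k\<^sub>i a' - i) \<xi>\<^sub>i\<close>.  Inserting it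
  into the top coefficient of the commutator of \<open>D\<^sub>i\<close> and \<open>D\<^sub>j\<close> leaves
  \<open>(i k\<^sub>j - j k\<^sub>i) \<xi>\<^sub>i \<xi>\<^sub>j / a\<close>, so that for \<open>i \<noteq> j\<close> one has \<open>k\<^sub>i\<^sub>+\<^sub>j = k\<^sub>i + k\<^sub>j - 1\<close> unless \<open>i k\<^sub>j = j k\<^sub>i\<close>
  (\<open>degree_P_add\<close>).  The subalgebra spanned by \<open>L\<^sub>-\<^sub>1\<close>, \<open>L\<^sub>0\<close>, \<open>L\<^sub>1\<close> alone admits the solution
  \<open>(k\<^sub>-\<^sub>1, k\<^sub>1) = (0, 2)\<close>, which occurs for multiples of \<open>z\<^sup>2\<close>, \<open>z\<partial> + 1/2\<close> and \<open>\<partial>\<^sup>2\<close>; it and its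
  mirror image are excluded by \<open>L\<^sub>2\<close> and \<open>L\<^sub>-\<^sub>2\<close>.  Hence all \<open>D\<^sub>i\<close> with \<open>-2 \<le> i \<le> 2\<close> have order 1
  (\<open>degree_P\<close>).

  Write \<open>D\<^sub>i = a m\<^sub>i \<partial> + m\<^sub>i \<beta>\<^sub>i\<close> in this range, with Laurent series \<open>m\<^sub>i\<close> and \<open>\<beta>\<^sub>i\<close>.  The relations
  become \<open>a m\<^sub>i' = -i m\<^sub>i\<close> and \<open>m\<^sub>i\<^sub>+\<^sub>j = m\<^sub>i m\<^sub>j\<close> for \<open>i \<noteq> j\<close>, so with \<open>h = m\<^sub>1\<close> one has \<open>m\<^sub>i = h\<^sup>i\<close> and
  \<open>a = -h/h'\<close>; furthermore \<open>\<beta>\<^sub>i - b\<close> is a constant, and it is linear in \<open>i\<close>.  That \<open>h\<close> is a unit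
  follows from the valuation: if \<open>h\<close> had order \<open>v \<noteq> 0\<close>, then \<open>a\<close> would have order 1, and the
  power series \<open>a h\<^sup>2\<close> and \<open>a h\<^sup>-\<^sup>2\<close> would force \<open>1 \<plusminus> 2v \<ge> 0\<close>,
  which no integer \<open>v \<noteq> 0\<close> satisfies.  Since \<open>h\<close> is a unit and \<open>h/h'\<close>
  is a power series, \<open>h'\<close> is a unit, too (\<open>exists_triple\<close>).

  Conversely, the operators of a triple satisfy the Witt relations by a direct computation
  (\<open>fls_op_commutator\<close>).  As \<open>L\<^sub>\<plusminus>\<^sub>1\<close> and \<open>L\<^sub>\<plusminus>\<^sub>2\<close> generate the Witt algebra, a representation that
  agrees with these operators for \<open>-2 \<le> i \<le> 2\<close> agrees with them everywhere.

  The brackets used to analyse a representation have no central term in the Virasoro algebra: either \<open>i + j \<noteq> 0\<close>, or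
  the factor \<open>i\<^sup>3 - i\<close> is 0.  So the classification holds for both algebras, and then the bracket of
  \<open>L\<^sub>2\<close> and \<open>L\<^sub>-\<^sub>2\<close> shows that \<open>K\<close> acts by 0.
\<close>

section \<open>Differential operators as polynomials in \<open>\<partial>\<close>\<close>

text \<open>
  The polynomial variable stands for \<open>\<partial>\<close>, written to the right of the coefficients.  In contrast to
  the coefficient sequences of \<^const>\<open>diff_op\<close>, the coefficients of a polynomial vanish beyond its degree,
  so that an operator determines its polynomial (\<open>op_of_inject\<close>).
\<close>

definition op_of :: "complex fps poly \<Rightarrow> fps_op"
  where "op_of P f = (\<Sum>j\<le>degree P. coeff P j * (fps_deriv ^^ j) f)"

lemma op_of_eq_sum: "degree P \<le> n \<Longrightarrow> op_of P f = (\<Sum>j\<le>n. coeff P j * (fps_deriv ^^ j) f)"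
  unfolding op_of_def by (rule sum.mono_neutral_left) (auto simp: coeff_eq_0)

lemma op_of_0 [simp]: "op_of 0 f = 0"
  by (simp add: op_of_def)

lemma op_of_add: "op_of (P + Q) f = op_of P f + op_of Q f"
proof -
  define n where "n = max (degree P) (degree Q)"
  have "degree (P + Q) \<le> n" "degree P \<le> n" "degree Q \<le> n"
    by (auto simp: n_def degree_add_le)
  thus ?thesis by (simp add: op_of_eq_sum[where n = n] algebra_simps sum.distrib)
qed

lemma op_of_smult: "op_of (smult a P) f = a * op_of P f"
  by (simp add: op_of_eq_sum[of "smult a P" "degree P"] op_of_def sum_distrib_left mult.assoc)

lemma op_of_diff: "op_of (P - Q) f = op_of P f - op_of Q f"
  using op_of_add[of P "smult (-1) Q" f] op_of_smult[of "-1" Q f] by simp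

lemma op_of_sum: "op_of (\<Sum>x\<in>A. P x) f = (\<Sum>x\<in>A. op_of (P x) f)"
  by (induction A rule: infinite_finite_induct) (auto simp: op_of_add)

text \<open>
  Horner's scheme; it reduces most facts about operators to induction on the polynomial.
\<close>

lemma op_of_pCons: "op_of (pCons a P) f = a * f + op_of P (fps_deriv f)"
proof -
  have "op_of (pCons a P) f = (\<Sum>j\<le>Suc (degree P). coeff (pCons a P) j * (fps_deriv ^^ j) f)"
    by (rule op_of_eq_sum) (simp add: degree_pCons_le)
  thus ?thesis
    by (subst (asm) sum.atMost_Suc_shift) (simp add: op_of_def funpow_swap1)
qed

lemma diff_op_eq_op_of: "diff_op k \<xi> = op_of (\<Sum>j\<le>k. monom (\<xi> j) j)"
proof
  fix f
  let ?P = "\<Sum>j\<le>k. monom (\<xi> j) j"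
  have "degree ?P \<le> k"
    by (rule degree_sum_le) (auto intro: order_trans[OF degree_monom_le])
  moreover have "coeff ?P j = \<xi> j" if "j \<le> k" for j
    using that by (simp add: coeff_sum)
  ultimately show "diff_op k \<xi> f = op_of ?P f"
    by (simp add: diff_op_def op_of_eq_sum)
qed

lemma op_of_eq_diff_op: "op_of P = diff_op (degree P) (coeff P)"
  by (simp add: fun_eq_iff op_of_def diff_op_def)

lemma Diff_eq_range_op_of: "Diff = range op_of"
proof
  show "Diff \<subseteq> range op_of" by (auto simp: Diff_def diff_op_eq_op_of)
  show "range op_of \<subseteq> Diff" unfolding Diff_def using op_of_eq_diff_op by blast
qed

lemma op_of_arg_0 [simp]: "op_of P 0 = 0"
  by (induction P) (auto simp: op_of_pCons)

text \<open>
  Evaluation at 1 kills the constant coefficient.  What remains is an operator applied to the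
  derivative of the argument, and every power series is a derivative.
\<close>

lemma op_of_eq_0_imp:
  assumes "\<And>f. op_of P f = 0"
  shows "P = 0"
  using assms
proof (induction P)
  case (pCons a P)
  have a: "a = 0" using pCons.prems[of 1] by (simp add: op_of_pCons)
  have "op_of P f = 0" for f
    using pCons.prems[of "fps_integral0 f"] by (simp add: op_of_pCons a fps_deriv_fps_integral)
  with pCons.IH a show ?case by simp
qed auto

lemma op_of_inject: "op_of P = op_of Q \<longleftrightarrow> P = Q"
  using op_of_eq_0_imp[of "P - Q"] by (auto simp: op_of_diff)

lemma has_order_op_of: "has_order (op_of P) k \<longleftrightarrow> P \<noteq> 0 \<and> degree P = k"
proof
  assume "has_order (op_of P) k"
  then obtain \<xi> where \<xi>: "\<xi> k \<noteq> 0" "op_of P = diff_op k \<xi>" by (auto simp: has_order_def)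
  let ?P = "\<Sum>j\<le>k. monom (\<xi> j) j"
  have P: "P = ?P" using \<xi>(2) by (simp add: diff_op_eq_op_of op_of_inject)
  have "degree ?P \<le> k"
    by (rule degree_sum_le) (auto intro: order_trans[OF degree_monom_le])
  moreover have "coeff ?P k = \<xi> k" by (simp add: coeff_sum)
  ultimately show "P \<noteq> 0 \<and> degree P = k" using \<xi>(1) P
    by (metis coeff_0 le_antisym le_degree)
next
  assume "P \<noteq> 0 \<and> degree P = k"
  thus "has_order (op_of P) k"
    unfolding has_order_def op_of_eq_diff_op by (intro exI[of _ "coeff P"]) auto
qed

section \<open>The top coefficient of a commutator\<close>

text \<open>
  The composition \<open>\<partial> \<circ> P = P \<partial> + P'\<close>, where \<open>P'\<close> is obtained by differentiating the coefficients.
\<close>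

definition deriv_times :: "complex fps poly \<Rightarrow> complex fps poly"
  where "deriv_times P = pCons 0 P + map_poly fps_deriv P"

lemma op_of_deriv_times: "op_of (deriv_times P) f = fps_deriv (op_of P f)"
proof -
  have "fps_deriv (op_of P f) = op_of P (fps_deriv f) + op_of (map_poly fps_deriv P) f"
    by (induction P arbitrary: f) (simp_all add: op_of_pCons map_poly_pCons algebra_simps)
  thus ?thesis by (simp add: deriv_times_def op_of_add op_of_pCons)
qed

definition op_times :: "complex fps poly \<Rightarrow> complex fps poly \<Rightarrow> complex fps poly"
  where "op_times P Q = (\<Sum>j\<le>degree P. smult (coeff P j) ((deriv_times ^^ j) Q))"

lemma op_of_op_times: "op_of (op_times P Q) f = op_of P (op_of Q f)"
proof -
  have "op_of ((deriv_times ^^ j) Q) f = (fps_deriv ^^ j) (op_of Q f)" for j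
    by (induction j) (auto simp: op_of_deriv_times)
  thus ?thesis by (simp add: op_times_def op_of_sum op_of_smult op_of_def[of P])
qed

lemma coeff_deriv_times:
  "coeff (deriv_times P) n = coeff (pCons 0 P) n + fps_deriv (coeff P n)"
  by (simp add: deriv_times_def coeff_map_poly)

text \<open>
  Here and below, \<open>coeff (pCons 0 Q) l\<close> is the coefficient of \<open>Q\<close> at \<open>l - 1\<close>, read as 0 if \<open>l = 0\<close>.
  This avoids a case distinction on natural subtraction.
\<close>

lemma deriv_times_funpow_top:
  assumes "degree Q \<le> l"
  shows "degree ((deriv_times ^^ j) Q) \<le> l + j"
    and "coeff ((deriv_times ^^ j) Q) (l + j) = coeff Q l"
    and "coeff (pCons 0 ((deriv_times ^^ j) Q)) (l + j)
           = coeff (pCons 0 Q) l + of_nat j * fps_deriv (coeff Q l)"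
proof (induction j)
  case (Suc j)
  let ?R = "(deriv_times ^^ j) Q"
  have z: "coeff ?R n = 0" if "n > l + j" for n
    using Suc.IH(1) that by (intro coeff_eq_0) simp
  { case 1 show ?case
      by (rule degree_le) (auto simp: coeff_deriv_times coeff_pCons z split: nat.split) }
  { case 2 show ?case using Suc.IH(2) by (simp add: coeff_deriv_times z) }
  { case 3 show ?case using Suc.IH(2,3) by (simp add: coeff_deriv_times algebra_simps) }
qed (use assms in auto)

text \<open>
  Only the summands \<open>j = k\<close> and \<open>j = k - 1\<close> of the product reach the two top degrees.
\<close>

lemma op_times_top:
  assumes P: "degree P \<le> k" and Q: "degree Q \<le> l"
  shows "n > k + l \<Longrightarrow> coeff (op_times P Q) n = 0"
    and "coeff (op_times P Q) (k + l) = coeff P k * coeff Q l"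
    and "coeff (pCons 0 (op_times P Q)) (k + l)
           = coeff P k * (coeff (pCons 0 Q) l + of_nat k * fps_deriv (coeff Q l))
             + coeff (pCons 0 P) k * coeff Q l"
proof -
  let ?T = "\<lambda>j. (deriv_times ^^ j) Q"
  note T = deriv_times_funpow_top[OF Q]
  have eq: "op_times P Q = (\<Sum>j\<le>k. smult (coeff P j) (?T j))"
    unfolding op_times_def using P
    by (intro sum.mono_neutral_left) (auto simp: coeff_eq_0)
  have z: "coeff (?T j) n = 0" if "n > l + j" for n j
    using T(1)[of j] that by (intro coeff_eq_0) simp
  show "coeff (op_times P Q) n = 0" if "n > k + l"
    using that by (auto simp: eq coeff_sum z intro!: sum.neutral)
  have "coeff (op_times P Q) (k + l) = (\<Sum>j\<in>{k}. coeff P j * coeff (?T j) (k + l))"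
    unfolding eq coeff_sum coeff_smult
    by (rule sum.mono_neutral_right) (auto simp: z)
  thus "coeff (op_times P Q) (k + l) = coeff P k * coeff Q l"
    using T(2)[of k] by (simp add: add.commute)
  have pc: "coeff (pCons 0 (op_times P Q)) n = (\<Sum>j\<le>k. coeff P j * coeff (pCons 0 (?T j)) n)" for n
    by (cases n) (simp_all add: eq coeff_sum)
  show "coeff (pCons 0 (op_times P Q)) (k + l)
           = coeff P k * (coeff (pCons 0 Q) l + of_nat k * fps_deriv (coeff Q l))
             + coeff (pCons 0 P) k * coeff Q l"
  proof (cases k)
    case 0
    thus ?thesis unfolding pc using T(3)[of 0] by simp
  next
    case (Suc k')
    have "(\<Sum>j\<le>k'. coeff P j * coeff (?T j) (k' + l))
          = (\<Sum>j\<in>{k'}. coeff P j * coeff (?T j) (k' + l))"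
      by (rule sum.mono_neutral_right) (auto simp: z)
    also have "\<dots> = coeff P k' * coeff Q l" using T(2)[of k'] by (simp add: add.commute)
    finally show ?thesis unfolding pc using T(3)[of k] Suc by (simp add: add.commute)
  qed
qed

definition op_comm :: "complex fps poly \<Rightarrow> complex fps poly \<Rightarrow> complex fps poly"
  where "op_comm P Q = op_times P Q - op_times Q P"

lemma op_of_op_comm: "op_of (op_comm P Q) = commutator (op_of P) (op_of Q)"
  by (simp add: fun_eq_iff op_comm_def commutator_def op_of_diff op_of_op_times)

text \<open>
  The Poisson bracket of the leading terms.  In the top degree \<open>k + l\<close> the two products agree because
  coefficients commute; one degree below, the subleading coefficients of \<open>P\<close> and \<open>Q\<close> cancel as well.
  For \<open>k = l = 0\<close> both sides of the second equation are 0.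
\<close>

lemma op_comm_top:
  assumes "degree P \<le> k" "degree Q \<le> l"
  shows "n \<ge> k + l \<Longrightarrow> coeff (op_comm P Q) n = 0"
    and "coeff (pCons 0 (op_comm P Q)) (k + l)
           = of_nat k * coeff P k * fps_deriv (coeff Q l)
             - of_nat l * coeff Q l * fps_deriv (coeff P k)"
proof -
  note PQ = op_times_top[OF assms] and QP = op_times_top[OF assms(2,1)]
  show "coeff (op_comm P Q) n = 0" if "n \<ge> k + l"
  proof (cases "n = k + l")
    case True
    thus ?thesis using PQ(2) QP(2) by (simp add: op_comm_def add.commute)
  next
    case False
    thus ?thesis using that PQ(1)[of n] QP(1)[of n] by (simp add: op_comm_def)
  qed
  have "coeff (pCons 0 (op_comm P Q)) (k + l) =
      coeff (pCons 0 (op_times P Q)) (k + l) - coeff (pCons 0 (op_times Q P)) (l + k)"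
    by (cases "k + l") (auto simp: op_comm_def add.commute)
  thus "coeff (pCons 0 (op_comm P Q)) (k + l)
           = of_nat k * coeff P k * fps_deriv (coeff Q l)
             - of_nat l * coeff Q l * fps_deriv (coeff P k)"
    unfolding PQ(3) QP(3) by (simp add: algebra_simps)
qed

section \<open>Lie homomorphisms as linear extensions\<close>

lemma op_of_linear:
  "op_of P (f + g) = op_of P f + op_of P g" "op_of P (fps_const c * f) = fps_const c * op_of P f"
  by (induction P arbitrary: f g)
     (auto simp: op_of_pCons distrib_left add_ac mult.left_commute[of _ "fps_const c"])

lemma Diff_linear:
  assumes "D \<in> Diff"
  shows "D (f + g) = D f + D g" "D (fps_const c * f) = fps_const c * D f"
  using assms op_of_linear by (auto simp: Diff_eq_range_op_of)

lemma Diff_sum: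
  assumes "D \<in> Diff"
  shows "D (\<Sum>x\<in>A. f x) = (\<Sum>x\<in>A. D (f x))"
proof -
  have "D 0 = 0" using Diff_linear(2)[OF assms, of 0 0] by simp
  thus ?thesis by (induction A rule: infinite_finite_induct) (auto simp: Diff_linear[OF assms])
qed

lemma Diff_lin_comb:
  assumes "\<And>x. x \<in> A \<Longrightarrow> D x \<in> Diff"
  shows "(\<lambda>f. \<Sum>x\<in>A. u x * D x f) \<in> Diff"
proof -
  have "\<forall>x\<in>A. \<exists>p. D x = op_of p" using assms by (auto simp: Diff_eq_range_op_of)
  then obtain p where p: "\<forall>x\<in>A. D x = op_of (p x)" by metis
  have "(\<lambda>f. \<Sum>x\<in>A. u x * D x f) = op_of (\<Sum>x\<in>A. smult (u x) (p x))"
    using p by (simp add: fun_eq_iff op_of_sum op_of_smult)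
  thus ?thesis by (auto simp: Diff_eq_range_op_of)
qed

lemma lookup_scale_vec: "Poly_Mapping.lookup (scale_vec a x) g = a * Poly_Mapping.lookup x g"
  by (simp add: scale_vec_def Poly_Mapping.map.rep_eq when_def)

lemma poly_mapping_eq_sum_basis:
  "x = (\<Sum>g\<in>Poly_Mapping.keys x. scale_vec (Poly_Mapping.lookup x g) (basis_vec g))"
  by (rule poly_mapping_eqI)
     (auto simp: lookup_sum lookup_scale_vec basis_vec_def lookup_single when_def in_keys_iff if_distrib cong: if_cong)

definition lin_ext :: "('g \<Rightarrow> fps_op) \<Rightarrow> ('g \<Rightarrow>\<^sub>0 complex) \<Rightarrow> fps_op"
  where "lin_ext E x f = (\<Sum>g\<in>Poly_Mapping.keys x. fps_const (Poly_Mapping.lookup x g) * E g f)"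

lemma lin_ext_eq_sum:
  assumes "finite S" "Poly_Mapping.keys x \<subseteq> S"
  shows "lin_ext E x f = (\<Sum>g\<in>S. fps_const (Poly_Mapping.lookup x g) * E g f)"
  unfolding lin_ext_def using assms
  by (intro sum.mono_neutral_left) (auto simp: in_keys_iff)

lemma lin_ext_0 [simp]: "lin_ext E 0 f = 0"
  by (simp add: lin_ext_def)

lemma lin_ext_add: "lin_ext E (x + y) f = lin_ext E x f + lin_ext E y f"
proof -
  let ?S = "Poly_Mapping.keys x \<union> Poly_Mapping.keys y"
  have S: "Poly_Mapping.keys (x + y) \<subseteq> ?S" by (rule Poly_Mapping.keys_add)
  show ?thesis
    by (subst (1 2 3) lin_ext_eq_sum[where S = ?S])
       (use S in \<open>auto simp: lookup_add sum.distrib algebra_simps simp flip: fps_const_add\<close>)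
qed

lemma lin_ext_scale: "lin_ext E (scale_vec a x) f = fps_const a * lin_ext E x f"
proof -
  have "Poly_Mapping.keys (scale_vec a x) \<subseteq> Poly_Mapping.keys x"
    by (auto simp: in_keys_iff lookup_scale_vec)
  thus ?thesis
    by (subst lin_ext_eq_sum[where S = "Poly_Mapping.keys x"])
       (auto simp: lin_ext_def lookup_scale_vec sum_distrib_left mult.assoc simp flip: fps_const_mult)
qed

lemma lin_ext_sum: "lin_ext E (\<Sum>i\<in>A. x i) f = (\<Sum>i\<in>A. lin_ext E (x i) f)"
  by (induction A rule: infinite_finite_induct) (auto simp: lin_ext_add)

lemma lin_ext_basis [simp]: "lin_ext E (basis_vec g) = E g"
  by (simp add: fun_eq_iff lin_ext_def basis_vec_def)

text \<open>
  Operators in \<^const>\<open>Diff\<close> are linear, so the commutator is bilinear on them, and it suffices to check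
  the homomorphism property on basis vectors.
\<close>

lemma lin_ext_in_lie_homs:
  assumes E: "\<And>g. E g \<in> Diff"
    and br: "\<And>g g'. lin_ext E (br g g') = commutator (E g) (E g')"
  shows "lin_ext E \<in> lie_homs_Diff (bilinear_ext br)"
proof -
  have "lin_ext E x \<in> Diff" for x
    using Diff_lin_comb[of "Poly_Mapping.keys x" E "\<lambda>g. fps_const (Poly_Mapping.lookup x g)"] E
    by (simp add: lin_ext_def[abs_def])
  moreover have "lin_ext E (bilinear_ext br x y) f = commutator (lin_ext E x) (lin_ext E y) f" for x y f
  proof -
    let ?x = "Poly_Mapping.lookup x" and ?y = "Poly_Mapping.lookup y"
    let ?X = "Poly_Mapping.keys x" and ?Y = "Poly_Mapping.keys y"
    have "lin_ext E (bilinear_ext br x y) f =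
        (\<Sum>g\<in>?X. \<Sum>g'\<in>?Y. fps_const (?x g) * fps_const (?y g') * (E g (E g' f) - E g' (E g f)))"
      by (simp add: bilinear_ext_def lin_ext_sum lin_ext_scale br commutator_def)
    also have "\<dots> = (\<Sum>g\<in>?X. \<Sum>g'\<in>?Y. fps_const (?x g) * (fps_const (?y g') * E g (E g' f)))
        - (\<Sum>g\<in>?X. \<Sum>g'\<in>?Y. fps_const (?y g') * (fps_const (?x g) * E g' (E g f)))"
      by (simp add: sum_subtractf[symmetric] right_diff_distrib mult_ac del: fps_const_mult)
    also have "(\<Sum>g\<in>?X. \<Sum>g'\<in>?Y. fps_const (?y g') * (fps_const (?x g) * E g' (E g f)))
        = (\<Sum>g'\<in>?Y. \<Sum>g\<in>?X. fps_const (?y g') * (fps_const (?x g) * E g' (E g f)))"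
      by (rule sum.swap)
    finally show ?thesis
      by (simp add: commutator_def lin_ext_def Diff_sum[OF E] Diff_linear[OF E] sum_distrib_left)
  qed
  ultimately show ?thesis
    by (auto simp: lie_homs_Diff_def lin_ext_add lin_ext_scale)
qed

lemma lie_hom_eq_lin_ext:
  assumes "\<rho> \<in> lie_homs_Diff br"
  shows "\<rho> = lin_ext (\<lambda>g. \<rho> (basis_vec g))"
proof (intro ext)
  fix x f
  have add: "\<rho> (x + y) f = \<rho> x f + \<rho> y f" and scale: "\<rho> (scale_vec a x) f = fps_const a * \<rho> x f"
    for x y a f using assms by (auto simp: lie_homs_Diff_def)
  have "\<rho> 0 f = 0" using add[of 0 0] by simp
  hence sum: "\<rho> (\<Sum>i\<in>A. u i) f = (\<Sum>i\<in>A. \<rho> (u i) f)" for A and u :: "'a \<Rightarrow> _"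
    by (induction A rule: infinite_finite_induct) (auto simp: add)
  show "\<rho> x f = lin_ext (\<lambda>g. \<rho> (basis_vec g)) x f"
    by (subst poly_mapping_eq_sum_basis[of x]) (simp add: sum scale lin_ext_def)
qed

section \<open>The operators attached to a triple\<close>

lemma power_series_iff: "F \<in> power_series \<longleftrightarrow> fls_subdegree F \<ge> 0"
proof
  assume "fls_subdegree F \<ge> 0"
  hence "F = fps_to_fls (fls_regpart F)" by simp
  thus "F \<in> power_series" unfolding power_series_def by (rule range_eqI)
qed (auto simp: power_series_def fls_subdegree_fls_to_fps_gt0)

lemma unit_power_series_iff: "F \<in> unit_power_series \<longleftrightarrow> F \<noteq> 0 \<and> fls_subdegree F = 0"
proof
  assume *: "F \<noteq> 0 \<and> fls_subdegree F = 0"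
  hence "F = fps_to_fls (fls_regpart F)" by simp
  moreover have "fls_regpart F dvd 1" using * nth_fls_subdegree_nonzero[of F] by auto
  ultimately show "F \<in> unit_power_series" unfolding unit_power_series_def by blast
next
  assume "F \<in> unit_power_series"
  thus "F \<noteq> 0 \<and> fls_subdegree F = 0"
    by (auto simp: unit_power_series_def fls_subdegree_fls_to_fps subdegree_eq_0_iff)
qed

lemma power_series_closed:
  "F \<in> power_series \<Longrightarrow> G \<in> power_series \<Longrightarrow> F + G \<in> power_series"
  "F \<in> power_series \<Longrightarrow> G \<in> power_series \<Longrightarrow> F * G \<in> power_series"
  "fls_const c \<in> power_series"
  unfolding power_series_def
  by (auto simp flip: fps_to_fls_plus fls_times_fps_to_fls)
     (metis fps_const_to_fls range_eqI)

lemma fls_deriv_power_int: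
  fixes h :: "complex fls"
  assumes h: "h \<noteq> 0"
  shows "h * fls_deriv (h powi i) = of_int i * h powi i * fls_deriv h"
proof (induction i rule: int_induct[where k = 0])
  case (step1 i)
  have "h powi (i + 1) = h powi i * h" using h by (simp add: power_int_add)
  thus ?case using step1 by (simp add: algebra_simps)
next
  case (step2 i)
  have i: "h powi i = h powi (i - 1) * h" using h by (simp add: power_int_diff)
  have "h * (h * fls_deriv (h powi (i - 1))) = h * (of_int (i - 1) * h powi (i - 1) * fls_deriv h)"
    using step2(2) unfolding i by (simp add: algebra_simps)
  thus ?case using h by simp
qed auto

text \<open>
  The expression \<^const>\<open>L_expr\<close> as an operator on all Laurent series, where it can be composed with
  itself.  Splitting \<open>h\<^sup>i\<^sup>+\<^sup>1/h'\<close> as \<open>(h/h') h\<^sup>i\<close> shows the common factor of all these vector fields.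
\<close>

definition fls_op :: "complex fls \<Rightarrow> complex fls \<Rightarrow> complex \<Rightarrow> int \<Rightarrow> complex fls \<Rightarrow> complex fls"
  where "fls_op h b c i F = - h / fls_deriv h * h powi i * fls_deriv F
           + (b + fls_const (of_int i * c)) * h powi i * F"

lemma L_expr_eq_fls_op: "h \<noteq> 0 \<Longrightarrow> L_expr h b c i f = fls_op h b c i (fps_to_fls f)"
  by (simp add: L_expr_def fls_op_def power_int_add)

lemma first_order_commutator:
  fixes a b d e F :: "complex fls"
  defines "D \<equiv> \<lambda>F. a * fls_deriv F + b * F" and "E \<equiv> \<lambda>F. d * fls_deriv F + e * F"
  shows "D (E F) - E (D F) =
    (a * fls_deriv d - d * fls_deriv a) * fls_deriv F + (a * fls_deriv e - d * fls_deriv b) * F"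
  by (simp add: D_def E_def algebra_simps)

text \<open>
  With \<open>A = -h/h'\<close> the derivation \<open>A \<partial>\<close> multiplies \<open>h\<^sup>i\<close> by \<open>-i\<close>.  The terms with \<open>A'\<close> and \<open>b'\<close> are
  symmetric in \<open>i\<close> and \<open>j\<close> and cancel; for the part with \<open>c\<close> one uses \<open>i\<^sup>2 - j\<^sup>2 = (i - j)(i + j)\<close>.
\<close>

lemma fls_op_commutator:
  assumes h: "h \<noteq> 0" "fls_deriv h \<noteq> 0"
  shows "fls_op h b c i (fls_op h b c j F) - fls_op h b c j (fls_op h b c i F)
    = of_int (i - j) * fls_op h b c (i + j) F"
proof -
  define A where "A = - h / fls_deriv h"
  define m where "m = (\<lambda>i. h powi i)"
  define C where "C = fls_const c"
  have m': "A * fls_deriv (m i) = - of_int i * m i" for i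
    using fls_deriv_power_int[OF h(1), of i] h by (simp add: A_def m_def field_simps)
  have m_add: "m (i + j) = m i * m j" using h by (simp add: m_def power_int_add)
  have C: "fls_const (of_int i * c) = of_int i * C" for i
    by (simp add: C_def fls_const_mult_const[symmetric] fls_of_int del: fls_const_mult_const)
  have C': "fls_deriv C = 0" by (simp add: C_def)
  have op: "fls_op h b c i F = A * m i * fls_deriv F + (b + of_int i * C) * m i * F" for i F
    by (simp add: fls_op_def A_def m_def C)
  have *: "A * m i * fls_deriv (A * m j) = m i * m j * (A * fls_deriv A) - of_int j * A * (m i * m j)" for i j
  proof -
    have "A * m i * fls_deriv (A * m j) = m i * m j * (A * fls_deriv A) + A * m i * (A * fls_deriv (m j))"
      by (simp add: algebra_simps)
    thus ?thesis unfolding m' by (simp add: algebra_simps)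
  qed
  have **: "A * m i * fls_deriv ((b + of_int j * C) * m j)
      = m i * m j * (A * fls_deriv b) - of_int j * (b + of_int j * C) * (m i * m j)" for i j
  proof -
    have "A * m i * fls_deriv ((b + of_int j * C) * m j)
      = m i * m j * (A * fls_deriv b) + (b + of_int j * C) * m i * (A * fls_deriv (m j))"
      by (simp add: C' algebra_simps)
    thus ?thesis unfolding m' by (simp add: algebra_simps)
  qed
  show ?thesis
    unfolding op first_order_commutator * ** m_add by (simp add: algebra_simps)
qed

lemma triplesD:
  assumes "(h, b, c) \<in> triples"
  shows "h \<noteq> 0" "fls_deriv h \<noteq> 0" "h powi i \<in> power_series" "- h / fls_deriv h \<in> power_series"
    "b \<in> power_series"
proof -
  have *: "h \<in> unit_power_series" "fls_deriv h \<in> unit_power_series" and b: "b \<in> power_series"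
    using assms by (auto simp: triples_def)
  thus h: "h \<noteq> 0" "fls_deriv h \<noteq> 0" by (auto simp: unit_power_series_iff)
  show "h powi i \<in> power_series" "- h / fls_deriv h \<in> power_series" "b \<in> power_series"
    using * b h by (auto simp: power_series_iff unit_power_series_iff fls_divide_subdegree)
qed

text \<open>
  For a triple in \<^const>\<open>triples\<close> the value of \<^const>\<open>L_expr\<close> is a power series, and
  \<^const>\<open>fls_regpart\<close> only changes its type.
\<close>

definition witt_op :: "complex fls \<times> complex fls \<times> complex \<Rightarrow> int \<Rightarrow> fps_op"
  where "witt_op t i f = (case t of (h, b, c) \<Rightarrow> fls_regpart (L_expr h b c i f))"

text \<open>
  The second part turns an equality of such operators, or a claim on their order, into a statement on
  Laurent series.
\<close>

lemma
  assumes "(h, b, c) \<in> triples"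
  shows witt_op_eq: "fps_to_fls (witt_op (h, b, c) i f) = L_expr h b c i f"
    and witt_op_first_order: "\<exists>p q. witt_op (h, b, c) i = op_of [:q, p:]
      \<and> fps_to_fls p = - h / fls_deriv h * h powi i
      \<and> fps_to_fls q = (b + fls_const (of_int i * c)) * h powi i"
proof -
  note t = triplesD[OF assms]
  let ?a = "- h / fls_deriv h * h powi i" and ?b = "(b + fls_const (of_int i * c)) * h powi i"
  have "?a \<in> power_series" "?b \<in> power_series"
    using t by (blast intro: power_series_closed)+
  then obtain p q where pq: "?a = fps_to_fls p" "?b = fps_to_fls q"
    by (auto simp: power_series_def)
  have L: "L_expr h b c i f = fps_to_fls (op_of [:q, p:] f)" for f
    unfolding L_expr_eq_fls_op[OF t(1)] fls_op_def pq
    by (simp add: op_of_pCons fls_deriv_fps_to_fls fls_times_fps_to_fls add.commute)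
  show "fps_to_fls (witt_op (h, b, c) i f) = L_expr h b c i f"
    by (simp add: witt_op_def L)
  show "\<exists>p q. witt_op (h, b, c) i = op_of [:q, p:] \<and> fps_to_fls p = ?a \<and> fps_to_fls q = ?b"
    using pq L by (intro exI[of _ p] exI[of _ q]) (simp add: fun_eq_iff witt_op_def)
qed

lemma witt_op_in_Diff: "t \<in> triples \<Longrightarrow> witt_op t i \<in> Diff"
  using witt_op_first_order[of "fst t" "fst (snd t)" "snd (snd t)" i]
  by (auto simp: Diff_eq_range_op_of)

lemma witt_op_commutator:
  assumes "t \<in> triples"
  shows "commutator (witt_op t i) (witt_op t j) f = of_int (i - j) * witt_op t (i + j) f"
proof -
  obtain h b c where t: "t = (h, b, c)" by (cases t)
  note T = assms[unfolded t]
  note d = triplesD[OF T]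
  have "fps_to_fls (commutator (witt_op t i) (witt_op t j) f)
      = fps_to_fls (of_int (i - j) * witt_op t (i + j) f)"
    using d(1,2)
    by (simp add: t commutator_def witt_op_eq[OF T] L_expr_eq_fls_op fls_op_commutator
        fls_times_fps_to_fls fps_to_fls_of_int del: of_int_diff)
  thus ?thesis by simp
qed

lemma has_order_witt_op_0:
  assumes "t \<in> triples"
  shows "has_order (witt_op t 0) 1"
proof -
  obtain h b c where t: "t = (h, b, c)" by (cases t)
  note T = assms[unfolded t]
  obtain p q where *: "witt_op t 0 = op_of [:q, p:]" "fps_to_fls p = - h / fls_deriv h"
    using witt_op_first_order[OF T, of 0] by (auto simp: t)
  have "p \<noteq> 0" using *(2) triplesD(1,2)[OF T] by auto
  thus ?thesis unfolding *(1) has_order_op_of by simp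
qed

text \<open>
  The index 0 gives \<open>b\<close> and \<open>h/h'\<close>; the quotient of the vector fields for 1 and 0 is \<open>h\<close>; then the
  coefficient of order 0 for the index 1 gives \<open>c\<close>.
\<close>

lemma witt_op_inject:
  assumes "t \<in> triples" "t' \<in> triples" "\<And>i. witt_op t i = witt_op t' i"
  shows "t = t'"
proof -
  obtain h b c where t: "t = (h, b, c)" by (cases t)
  obtain h' b' c' where t': "t' = (h', b', c')" by (cases t')
  note T = assms(1)[unfolded t] and T' = assms(2)[unfolded t']
  note d = triplesD[OF T] and d' = triplesD[OF T']
  have *: "- h / fls_deriv h * h powi i = - h' / fls_deriv h' * h' powi i
      \<and> (b + fls_const (of_int i * c)) * h powi i = (b' + fls_const (of_int i * c')) * h' powi i" for i
    using witt_op_first_order[OF T, of i] witt_op_first_order[OF T', of i] assms(3)[of i]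
    by (auto simp: t t' op_of_inject)
  have b: "b = b'" and A: "- h / fls_deriv h = - h' / fls_deriv h'" using *[of 0] by auto
  have h: "h = h'" using *[of 1] d d' unfolding A by simp
  have "fls_const c = fls_const c'" using *[of 1] d unfolding b h by simp
  hence "c = c'" by (metis fls_const_nth)
  thus ?thesis using b h by (simp add: t t')
qed

section \<open>Orders of the operators in a Witt action\<close>

lemma of_int_fps_eq_0_iff: "(of_int n :: complex fps) = 0 \<longleftrightarrow> n = 0"
  unfolding fps_of_int[symmetric] by simp

text \<open>
  The images of the \<open>L\<^sub>i\<close> under a homomorphism from either algebra.  The relations are required only for
  those pairs of indices for which the Virasoro bracket has no central term, namely when
  \<open>i + j \<noteq> 0\<close> or the cocycle \<open>i\<^sup>3 - i\<close> vanishes.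
\<close>

locale witt_family =
  fixes D :: "int \<Rightarrow> fps_op"
  assumes D_in_Diff: "D i \<in> Diff"
    and order_D0: "has_order (D 0) 1"
    and D_comm: "i + j \<noteq> 0 \<or> i ^ 3 = i \<Longrightarrow>
      commutator (D i) (D j) f = of_int (i - j) * D (i + j) f"
begin

text \<open>
  By \<open>op_of_inject\<close> there is only one such polynomial.
\<close>

definition P :: "int \<Rightarrow> complex fps poly"
  where "P i = (SOME p. D i = op_of p)"

lemma D_eq: "D i = op_of (P i)"
proof -
  have "\<exists>p. D i = op_of p" using D_in_Diff[of i] by (auto simp: Diff_eq_range_op_of)
  thus ?thesis unfolding P_def by (rule someI_ex)
qed

lemma P_comm:
  assumes "i + j \<noteq> 0 \<or> i ^ 3 = i"
  shows "op_comm (P i) (P j) = smult (of_int (i - j)) (P (i + j))"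
proof -
  have "op_of (op_comm (P i) (P j)) f = op_of (smult (of_int (i - j)) (P (i + j))) f" for f
    using D_comm[OF assms, of f] by (simp add: op_of_op_comm op_of_smult D_eq)
  thus ?thesis by (simp add: op_of_inject[symmetric] fun_eq_iff)
qed

lemma P0: "P 0 \<noteq> 0" "degree (P 0) = 1"
  using order_D0 by (simp_all add: D_eq has_order_op_of)

text \<open>
  The top coefficient of the relation \<open>D\<^sub>0 D\<^sub>i - D\<^sub>i D\<^sub>0 = -i D\<^sub>i\<close>.
\<close>

lemma lead_coeff_ode:
  "coeff (P 0) 1 * fps_deriv (lead_coeff (P i))
     = (of_nat (degree (P i)) * fps_deriv (coeff (P 0) 1) - of_int i) * lead_coeff (P i)"
proof -
  have "coeff (pCons 0 (op_comm (P 0) (P i))) (1 + degree (P i)) = of_int (- i) * lead_coeff (P i)"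
    by (subst P_comm) auto
  thus ?thesis
    by (subst (asm) op_comm_top(2)) (use P0(2) in \<open>auto simp: algebra_simps\<close>)
qed

text \<open>
  Multiplication operators commute.
\<close>

lemma not_both_degree_0:
  assumes "i + j \<noteq> 0 \<or> i ^ 3 = i" "i \<noteq> j" "P (i + j) \<noteq> 0"
  shows "degree (P i) + degree (P j) \<noteq> 0"
proof
  assume 0: "degree (P i) + degree (P j) = 0"
  have "op_comm (P i) (P j) = 0"
    by (rule poly_eqI) (use op_comm_top(1)[of "P i" 0 "P j" 0] 0 in auto)
  moreover have "(of_int (i - j) :: complex fps) \<noteq> 0"
    using assms(2) by (subst of_int_fps_eq_0_iff) simp
  ultimately show False using assms(3) P_comm[OF assms(1)] by simp
qed

text \<open>
  After multiplication by \<open>a\<close>, the differential equations of the leading coefficients \<open>p\<close> and \<open>q\<close> turn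
  the Poisson bracket \<open>k p q' - l q p'\<close> into \<open>(i l - j k) p q\<close>: the terms with \<open>a'\<close> cancel.  So under the
  last hypothesis the commutator has the largest order it can have.
\<close>

lemma degree_P_add:
  assumes ij: "i + j \<noteq> 0 \<or> i ^ 3 = i" "i \<noteq> j" and nz: "P i \<noteq> 0" "P j \<noteq> 0"
    and ne: "i * int (degree (P j)) \<noteq> j * int (degree (P i))"
  shows "degree (P (i + j)) + 1 = degree (P i) + degree (P j)"
proof -
  define k l where "k = degree (P i)" and "l = degree (P j)"
  define p q where "p = lead_coeff (P i)" and "q = lead_coeff (P j)"
  define a where "a = coeff (P 0) 1"
  have nz': "p \<noteq> 0" "q \<noteq> 0" using nz by (auto simp: p_def q_def)
  have p: "a * fps_deriv p = (of_nat k * fps_deriv a - of_int i) * p"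
    using lead_coeff_ode[of i] by (simp add: a_def k_def p_def)
  have q: "a * fps_deriv q = (of_nat l * fps_deriv a - of_int j) * q"
    using lead_coeff_ode[of j] by (simp add: a_def l_def q_def)
  let ?R = "op_comm (P i) (P j)"
  have "a * coeff (pCons 0 ?R) (k + l) =
      a * (of_nat k * p * fps_deriv q - of_nat l * q * fps_deriv p)"
    using op_comm_top(2)[of "P i" k "P j" l] by (simp add: k_def l_def p_def q_def)
  also have "\<dots> = of_nat k * p * (a * fps_deriv q) - of_nat l * q * (a * fps_deriv p)"
    by (simp add: algebra_simps)
  also have "\<dots> = of_int (i * int l - j * int k) * p * q"
    unfolding p q by (simp add: algebra_simps)
  finally have "coeff (pCons 0 ?R) (k + l) \<noteq> 0"
    using ne nz' of_int_fps_eq_0_iff[of "i * int l - j * int k"] unfolding k_def l_def by auto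
  then obtain n where n: "k + l = Suc n" and Rn: "coeff ?R n \<noteq> 0"
    by (cases "k + l") auto
  have "degree ?R = n"
  proof (rule antisym)
    show "degree ?R \<le> n"
      by (rule degree_le) (use op_comm_top(1)[of "P i" k "P j" l] n in \<open>auto simp: k_def l_def\<close>)
  qed (use Rn in \<open>rule le_degree\<close>)
  moreover have "degree ?R = degree (P (i + j))"
    using P_comm[OF ij(1)] ij(2) of_int_fps_eq_0_iff[of "i - j"] by simp
  ultimately show ?thesis using n by (simp add: k_def l_def)
qed

text \<open>
  If \<open>D\<^sub>1\<close> or \<open>D\<^sub>-\<^sub>1\<close> were 0, then so would be \<open>2 D\<^sub>0\<close>; similarly \<open>D\<^sub>\<plusminus>\<^sub>2 = 0\<close> would give \<open>D\<^sub>\<plusminus>\<^sub>1 = 0\<close>.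
\<close>

lemma P_nz: "P 1 \<noteq> 0" "P (-1) \<noteq> 0" "P 2 \<noteq> 0" "P (-2) \<noteq> 0"
proof -
  have 0: "op_comm Q 0 = 0" "op_comm 0 Q = 0" for Q
    using op_of_op_comm[of Q 0] op_of_op_comm[of 0 Q]
    by (auto simp: op_of_inject[symmetric] commutator_def)
  show 1: "P 1 \<noteq> 0" "P (-1) \<noteq> 0" using P_comm[of 1 "-1"] P0(1) by (auto simp: 0)
  show "P 2 \<noteq> 0" "P (-2) \<noteq> 0"
    using P_comm[of 2 "-1"] P_comm[of "-2" 1] 1 by (auto simp: 0)
qed

text \<open>
  The brackets of \<open>(L\<^sub>1, L\<^sub>-\<^sub>1)\<close>, \<open>(L\<^sub>2, L\<^sub>-\<^sub>1)\<close> and \<open>(L\<^sub>-\<^sub>2, L\<^sub>1)\<close> give three linear equations for the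
  orders, whose only solution in natural numbers is 1 throughout.
\<close>

lemma degree_P:
  "degree (P 1) = 1" "degree (P (-1)) = 1" "degree (P 2) = 1" "degree (P (-2)) = 1"
proof -
  define k l m n where "k = degree (P 1)" and "l = degree (P (-1))"
    and "m = degree (P 2)" and "n = degree (P (-2))"
  note defs = k_def l_def m_def n_def
  have "k + l \<noteq> 0" using not_both_degree_0[of 1 "-1"] P0 by (simp add: defs)
  hence "int l \<noteq> - int k" by linarith
  hence 1: "2 = k + l"
    using degree_P_add[of 1 "-1"] P0 P_nz by (simp add: defs)
  have "m + l \<noteq> 0" using not_both_degree_0[of 2 "-1"] P_nz by (simp add: defs)
  hence "2 * int l \<noteq> - int m" by linarith
  hence 2: "k + 1 = m + l"
    using degree_P_add[of 2 "-1"] P_nz by (simp add: defs)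
  have "n + k \<noteq> 0" using not_both_degree_0[of "-2" 1] P_nz by (simp add: defs)
  hence "- (2 * int k) \<noteq> int n" by linarith
  hence 3: "l + 1 = n + k"
    using degree_P_add[of "-2" 1] P_nz by (simp add: defs)
  have "k = 1 \<and> l = 1 \<and> m = 1 \<and> n = 1" using 1 2 3 by presburger
  thus "degree (P 1) = 1" "degree (P (-1)) = 1" "degree (P 2) = 1" "degree (P (-2)) = 1"
    by (simp_all add: defs)
qed

end

section \<open>Recovering the triple from first order operators\<close>

context witt_family
begin

text \<open>
  For indices in the range \<open>small\<close> below, the operator \<open>D i\<close> is \<open>A i \<partial> + B i\<close>.  The coefficients are
  viewed as Laurent series in order to divide by them.
\<close>

definition A :: "int \<Rightarrow> complex fls"
  where "A i = fps_to_fls (coeff (P i) 1)"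

definition B :: "int \<Rightarrow> complex fls"
  where "B i = fps_to_fls (coeff (P i) 0)"

text \<open>
  The indices for which the order is known to be 1.  They include those of the generators
  \<open>L\<^sub>\<plusminus>\<^sub>1\<close> and \<open>L\<^sub>\<plusminus>\<^sub>2\<close>, so it suffices to determine the operators with these indices.
\<close>

definition small :: "int set"
  where "small = {-2, -1, 0, 1, 2}"

lemma degree_P_small: "i \<in> small \<Longrightarrow> degree (P i) = 1"
  using P0 degree_P by (auto simp: small_def)

lemma A_nonzero: "i \<in> small \<Longrightarrow> A i \<noteq> 0"
  using degree_P_small[of i] leading_coeff_0_iff[of "P i"] by (auto simp: A_def)

lemma D_small: "i \<in> small \<Longrightarrow> fps_to_fls (D i f) = A i * fls_deriv (fps_to_fls f) + B i * fps_to_fls f"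
  using degree_P_small[of i]
  by (simp add: D_eq op_of_def A_def B_def fls_deriv_fps_to_fls fls_times_fps_to_fls add.commute)

text \<open>
  Coefficients of \<open>\<partial>\<close> and of 1 in the commutation relations, obtained by applying both sides to the
  series 1 and \<open>z\<close>.
\<close>

lemma first_order_relations:
  assumes ij: "i \<in> small" "j \<in> small" "i + j \<in> small" "i + j \<noteq> 0 \<or> i ^ 3 = i"
  shows "A i * fls_deriv (A j) - A j * fls_deriv (A i) = of_int (i - j) * A (i + j)"
    and "A i * fls_deriv (B j) - A j * fls_deriv (B i) = of_int (i - j) * B (i + j)"
proof -
  let ?p = "A i * fls_deriv (A j) - A j * fls_deriv (A i)"
  let ?q = "A i * fls_deriv (B j) - A j * fls_deriv (B i)"
  have eq: "?p * fls_deriv (fps_to_fls f) + ?q * fps_to_fls f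
      = of_int (i - j) * (A (i + j) * fls_deriv (fps_to_fls f) + B (i + j) * fps_to_fls f)" for f
  proof -
    have "fps_to_fls (commutator (D i) (D j) f) = of_int (i - j) * fps_to_fls (D (i + j) f)"
      by (simp add: D_comm[OF ij(4)] fls_times_fps_to_fls fps_to_fls_of_int del: of_int_diff)
    thus ?thesis
      unfolding commutator_def fps_to_fls_minus D_small[OF ij(1)] D_small[OF ij(2)] D_small[OF ij(3)]
        first_order_commutator .
  qed
  show q: "?q = of_int (i - j) * B (i + j)" using eq[of 1] by simp
  have X: "fls_deriv (fps_to_fls fps_X) = (1 :: complex fls)" by (simp add: fls_deriv_fps_to_fls)
  show "?p = of_int (i - j) * A (i + j)"
    using eq[of fps_X] unfolding X q by (simp add: distrib_left mult.assoc)
qed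

text \<open>
  The candidates for the powers \<open>h\<^sup>i\<close>.
\<close>

definition m :: "int \<Rightarrow> complex fls"
  where "m i = A i / A 0"

lemma A_0_nonzero: "A 0 \<noteq> 0"
  by (rule A_nonzero) (simp add: small_def)

lemma A_eq: "A i = A 0 * m i"
  using A_0_nonzero by (simp add: m_def)

text \<open>
  The relation with \<open>L\<^sub>0\<close>, which makes \<open>m i\<close> an eigenvector of the derivation \<open>A 0 \<partial>\<close>.
\<close>

lemma m_ode:
  assumes "i \<in> small"
  shows "A 0 * fls_deriv (m i) = - of_int i * m i"
proof -
  have "A i * fls_deriv (A 0) - A 0 * fls_deriv (A i) = of_int i * A i"
    using first_order_relations(1)[of i 0] assms by (simp add: small_def)
  hence "A 0 * (A 0 * fls_deriv (m i)) = A 0 * (- of_int i * m i)"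
    unfolding A_eq[of i] by (simp add: algebra_simps minus_equation_iff[of "A 0 * _"])
  thus ?thesis using A_0_nonzero by (simp only: mult_cancel_left) auto
qed

text \<open>
  In \<open>m\<^sub>i m\<^sub>j' - m\<^sub>j m\<^sub>i'\<close> the eigenvector equations replace the derivatives and leave
  \<open>(i - j) m\<^sub>i m\<^sub>j\<close>, up to the common factor \<open>A 0\<close>.
\<close>

lemma m_add:
  assumes ij: "i \<in> small" "j \<in> small" "i + j \<in> small" "i + j \<noteq> 0 \<or> i ^ 3 = i" "i \<noteq> j"
  shows "m (i + j) = m i * m j"
proof -
  have "of_int (i - j) * (A 0 * m (i + j)) = A i * fls_deriv (A j) - A j * fls_deriv (A i)"
    using first_order_relations(1)[OF ij(1-4)] A_eq[of "i + j"] by simp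
  also have "\<dots> = A 0 * (m i * (A 0 * fls_deriv (m j)) - m j * (A 0 * fls_deriv (m i)))"
    unfolding A_eq[of i] A_eq[of j] by (simp add: algebra_simps)
  also have "\<dots> = of_int (i - j) * (A 0 * (m i * m j))"
    unfolding m_ode[OF ij(1)] m_ode[OF ij(2)] by (simp add: algebra_simps)
  finally show ?thesis using ij(5) A_0_nonzero by simp
qed

text \<open>
  The candidates for \<open>b + i c\<close>.
\<close>

definition \<beta> :: "int \<Rightarrow> complex fls"
  where "\<beta> i = B i / m i"

lemma m_nonzero: "i \<in> small \<Longrightarrow> m i \<noteq> 0"
  using A_nonzero A_0_nonzero by (simp add: m_def)

lemma \<beta>_rel:
  assumes ij: "i \<in> small" "j \<in> small" "i + j \<in> small" "i + j \<noteq> 0 \<or> i ^ 3 = i" "i \<noteq> j"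
  shows "A 0 * (fls_deriv (\<beta> j) - fls_deriv (\<beta> i)) + of_int i * \<beta> i - of_int j * \<beta> j
           = of_int (i - j) * \<beta> (i + j)"
proof -
  have B: "B k = m k * \<beta> k" if "k \<in> small" for k
    using m_nonzero[OF that] by (simp add: \<beta>_def)
  have "m i * m j * (of_int (i - j) * \<beta> (i + j)) = A i * fls_deriv (B j) - A j * fls_deriv (B i)"
    using first_order_relations(2)[OF ij(1-4)] B[OF ij(3)] m_add[OF ij] by (simp add: mult_ac)
  also have "\<dots> = m i * (m j * A 0 * fls_deriv (\<beta> j) + \<beta> j * (A 0 * fls_deriv (m j)))
      - m j * (m i * A 0 * fls_deriv (\<beta> i) + \<beta> i * (A 0 * fls_deriv (m i)))"
    unfolding B[OF ij(1)] B[OF ij(2)] A_eq[of i] A_eq[of j] by (simp add: algebra_simps)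
  also have "\<dots> = m i * m j *
      (A 0 * (fls_deriv (\<beta> j) - fls_deriv (\<beta> i)) + of_int i * \<beta> i - of_int j * \<beta> j)"
    unfolding m_ode[OF ij(1)] m_ode[OF ij(2)] by (simp add: algebra_simps)
  finally show ?thesis using m_nonzero ij by simp
qed

text \<open>
  The relation with \<open>L\<^sub>0\<close> shows that all \<open>\<beta>\<^sub>i\<close> have the same derivative.  Then the derivatives drop out
  of the other relations, which become linear equations that express every \<open>\<beta>\<^sub>i\<close> by \<open>\<beta>\<^sub>0 = B 0\<close> and \<open>\<beta>\<^sub>1\<close>.
\<close>

lemma \<beta>_eq: "\<exists>c. \<forall>i\<in>small. \<beta> i = B 0 + fls_const (of_int i * c)"
proof -
  have m0: "m 0 = 1" using A_0_nonzero by (simp add: m_def)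
  have b0: "\<beta> 0 = B 0" by (simp add: \<beta>_def m0)
  have deriv: "fls_deriv (\<beta> i) = fls_deriv (B 0)" if "i \<in> small" "i \<noteq> 0" for i
    using \<beta>_rel[of i 0] that A_0_nonzero by (simp add: b0 small_def)
  have rel: "of_int i * \<beta> i - of_int j * \<beta> j = of_int (i - j) * \<beta> (i + j)"
    if "i \<in> small" "j \<in> small" "i + j \<in> small" "i + j \<noteq> 0 \<or> i ^ 3 = i" "i \<noteq> j" "i \<noteq> 0" "j \<noteq> 0" for i j
    using \<beta>_rel[OF that(1-5)] deriv that by simp
  have "fls_deriv (\<beta> 1) = fls_deriv (B 0)" by (rule deriv) (auto simp: small_def)
  then obtain c where 1: "\<beta> 1 = fls_const c + B 0" using fls_deriv_eq_iff_ex by blast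
  have 2: "\<beta> (-1) = 2 * B 0 - \<beta> 1" using rel[of 1 "-1"] by (simp add: small_def b0 algebra_simps)
  have 3: "2 * \<beta> 2 = 3 * \<beta> 1 - \<beta> (-1)" using rel[of 2 "-1"] by (simp add: small_def algebra_simps)
  have 4: "2 * \<beta> (-2) = 3 * \<beta> (-1) - \<beta> 1"
    using rel[of "-2" 1] by (simp add: small_def algebra_simps)
  have C: "fls_const (of_int i * c) = of_int i * fls_const c" for i
    by (simp add: fls_const_mult_const[symmetric] fls_of_int del: fls_const_mult_const)
  have "2 * \<beta> 2 = 2 * (B 0 + 2 * fls_const c)" "2 * \<beta> (-2) = 2 * (B 0 - 2 * fls_const c)"
    unfolding 3 4 2 1 by (simp_all add: algebra_simps)
  hence "\<beta> 2 = B 0 + 2 * fls_const c" "\<beta> (-2) = B 0 - 2 * fls_const c"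
    by (simp_all only: mult_cancel_left) auto
  hence "\<forall>i\<in>small. \<beta> i = B 0 + of_int i * fls_const c"
    using 1 2 b0 by (auto simp: small_def)
  thus ?thesis by (intro exI[of _ c]) (simp only: C)
qed

lemma m_eq: "i \<in> small \<Longrightarrow> m i = m 1 powi i"
proof -
  have 0: "m 0 = 1" using A_0_nonzero by (simp add: m_def)
  have nz: "m 1 \<noteq> 0" by (rule m_nonzero) (simp add: small_def)
  have 1: "m (-1) = inverse (m 1)" using m_add[of 1 "-1"] nz by (simp add: small_def 0 field_simps)
  have 2: "m 2 = m 1 * m 1" using m_add[of 2 "-1"] nz by (simp add: small_def 1 field_simps)
  have 3: "m (-2) = inverse (m 1) * inverse (m 1)"
    using m_add[of "-2" 1] nz by (simp add: small_def 1 field_simps)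
  show ?thesis if "i \<in> small"
    using that 0 1 2 3 by (auto simp: small_def power_int_minus power2_eq_square)
qed

lemma A_power_series: "A i \<in> power_series" "B i \<in> power_series"
  by (simp_all add: A_def B_def power_series_def)

text \<open>
  Here \<open>h = m 1\<close> and \<open>b = B 0\<close>.  The point that is not yet settled is that \<open>h\<close> and \<open>h'\<close> are units of the
  power series; it follows by comparing valuations as all \<open>A 0 h\<^sup>i\<close> with \<open>-2 \<le> i \<le> 2\<close> are power series.
\<close>

lemma exists_triple:
  obtains b c where "(m 1, b, c) \<in> triples"
    "\<And>i f. i \<in> small \<Longrightarrow> fps_to_fls (D i f) = L_expr (m 1) b c i f"
proof -
  define h where "h = m 1"
  have sm: "1 \<in> small" "2 \<in> small" "-2 \<in> small" "-1 \<in> small" "0 \<in> small" by (auto simp: small_def)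
  have h0: "h \<noteq> 0" unfolding h_def by (rule m_nonzero[OF sm(1)])
  have h': "A 0 * fls_deriv h = - h" using m_ode[OF sm(1)] by (simp add: h_def)
  hence h'0: "fls_deriv h \<noteq> 0" using h0 by auto
  have A0: "A 0 = - h / fls_deriv h" using h' h'0 by (simp add: field_simps)
  have nonneg: "fls_subdegree (A 0) + i * fls_subdegree h \<ge> 0" if "i \<in> small" for i
  proof -
    have "A i \<in> power_series" by (rule A_power_series)
    thus ?thesis using h0 A_0_nonzero
      by (simp add: A_eq[of i] m_eq[OF that] h_def[symmetric] power_series_iff)
  qed
  have sub: "fls_subdegree (A 0) + fls_subdegree (fls_deriv h) = fls_subdegree h"
    using arg_cong[OF h', of fls_subdegree] h'0 A_0_nonzero by simp
  have hs: "fls_subdegree h = 0"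
  proof (rule ccontr)
    assume "fls_subdegree h \<noteq> 0"
    \<comment> \<open>differentiation lowers a nonzero valuation by exactly 1\<close>
    hence "fls_subdegree (A 0) = 1" using sub fls_subdegree_deriv[of h] by simp
    thus False using nonneg[OF sm(2)] nonneg[OF sm(3)] \<open>fls_subdegree h \<noteq> 0\<close> by simp
  qed
  have h's: "fls_subdegree (fls_deriv h) = 0"
    using fls_deriv_subdegree0[OF hs] nonneg[OF sm(5)] sub hs by simp
  obtain c where c: "\<And>i. i \<in> small \<Longrightarrow> \<beta> i = B 0 + fls_const (of_int i * c)"
    using \<beta>_eq by blast
  have "(h, B 0, c) \<in> triples"
    using h0 h'0 hs h's A_power_series
    by (auto simp: triples_def T1_def power_series_iff unit_power_series_iff)
  moreover have "fps_to_fls (D i f) = L_expr h (B 0) c i f" if i: "i \<in> small" for i f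
  proof -
    have "A i = - h / fls_deriv h * h powi i"
      by (simp add: A_eq[of i] m_eq[OF i] h_def[symmetric] A0)
    moreover have "B i = (B 0 + fls_const (of_int i * c)) * h powi i"
      unfolding c[OF i, symmetric] h_def m_eq[OF i, symmetric] using m_nonzero[OF i]
      by (simp add: \<beta>_def)
    ultimately show ?thesis
      unfolding L_expr_eq_fls_op[OF h0] fls_op_def D_small[OF i] by simp
  qed
  ultimately show ?thesis using that unfolding h_def by blast
qed

text \<open>
  From \<open>L\<^sub>\<plusminus>\<^sub>2\<close> on, bracketing with \<open>L\<^sub>\<plusminus>\<^sub>1\<close> reaches the next index, with a nonzero factor \<open>i - j\<close> and
  without central terms.
\<close>

lemma D_eq_if_eq_on_small:
  assumes E: "\<And>i j f. commutator (E i) (E j) f = of_int (i - j) * E (i + j) f"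
    and small: "\<And>i. i \<in> small \<Longrightarrow> D i = E i"
  shows "D i = E i"
proof -
  have cancel: "of_int n * x = of_int n * y \<Longrightarrow> n \<noteq> 0 \<Longrightarrow> x = (y :: complex fps)" for n x y
    using of_int_fps_eq_0_iff by simp
  have step: "D (i + j) = E (i + j)" if "D i = E i" "D j = E j" "i + j \<noteq> 0" "i \<noteq> j" for i j
  proof
    fix f
    have "of_int (i - j) * D (i + j) f = commutator (D i) (D j) f"
      by (rule D_comm[symmetric]) (use that(3) in simp)
    also have "\<dots> = of_int (i - j) * E (i + j) f"
      unfolding that(1,2) by (rule E)
    finally show "D (i + j) f = E (i + j) f"
      by (rule cancel) (use that(4) in simp)
  qed
  have 1: "D 1 = E 1" "D (-1) = E (-1)" using small by (auto simp: small_def)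
  have pos: "D (int n + 2) = E (int n + 2)" for n
  proof (induction n)
    case (Suc n)
    thus ?case using step[of "int n + 2" 1] 1 by (simp add: algebra_simps)
  qed (use small in \<open>auto simp: small_def\<close>)
  have neg: "D (- int n - 2) = E (- int n - 2)" for n
  proof (induction n)
    case (Suc n)
    thus ?case using step[of "- int n - 2" "-1"] 1 by (simp add: algebra_simps)
  qed (use small in \<open>auto simp: small_def\<close>)
  consider n where "i = int n + 2" | n where "i = - int n - 2" | "i \<in> small"
  proof -
    have "i = int (nat (i - 2)) + 2 \<or> i = - int (nat (- i - 2)) - 2 \<or> i \<in> small"
      by (auto simp: small_def)
    thus ?thesis using that by blast
  qed
  thus ?thesis using pos neg small by cases blast+
qed

lemma witt_family_eq_witt_op:
  obtains t where "t \<in> triples" "D = witt_op t"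
proof -
  obtain b c where t: "(m 1, b, c) \<in> triples"
    and eq: "\<And>i f. i \<in> small \<Longrightarrow> fps_to_fls (D i f) = L_expr (m 1) b c i f"
    by (rule exists_triple) blast
  have "D i = witt_op (m 1, b, c) i" if "i \<in> small" for i
  proof
    fix f
    have "fps_to_fls (D i f) = fps_to_fls (witt_op (m 1, b, c) i f)"
      by (simp only: eq[OF that] witt_op_eq[OF t])
    thus "D i f = witt_op (m 1, b, c) i f" by simp
  qed
  hence "D = witt_op (m 1, b, c)"
    using D_eq_if_eq_on_small[OF witt_op_commutator[OF t]] by blast
  with t show ?thesis by (rule that)
qed

end

section \<open>The bijections\<close>

lemma witt_bij:
  "bij_betw (\<lambda>t. lin_ext (witt_op t)) triples
     {\<rho> \<in> lie_homs_Diff witt_bracket. has_order (\<rho> (basis_vec 0)) 1}"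
proof (rule bij_betwI')
  fix t t' assume "t \<in> triples" "t' \<in> triples"
  thus "lin_ext (witt_op t) = lin_ext (witt_op t') \<longleftrightarrow> t = t'"
    by (metis lin_ext_basis witt_op_inject)
next
  fix t assume t: "t \<in> triples"
  have "lin_ext (witt_op t) (scale_vec (of_int (i - j)) (basis_vec (i + j)))
      = commutator (witt_op t i) (witt_op t j)" for i j
    by (simp add: fun_eq_iff lin_ext_scale witt_op_commutator[OF t] fps_of_int del: of_int_diff)
  thus "lin_ext (witt_op t) \<in> {\<rho> \<in> lie_homs_Diff witt_bracket. has_order (\<rho> (basis_vec 0)) 1}"
    using t has_order_witt_op_0[OF t]
    by (auto simp: witt_bracket_def witt_op_in_Diff intro!: lin_ext_in_lie_homs simp del: of_int_diff)
next
  fix \<rho> assume "\<rho> \<in> {\<rho> \<in> lie_homs_Diff witt_bracket. has_order (\<rho> (basis_vec (0::int))) 1}"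
  hence \<rho>: "\<rho> \<in> lie_homs_Diff witt_bracket" and ord: "has_order (\<rho> (basis_vec 0)) 1" by auto
  have "witt_family (\<lambda>i. \<rho> (basis_vec i))"
  proof
    fix i j :: int and f
    have "\<rho> (witt_bracket (basis_vec i) (basis_vec j)) = commutator (\<rho> (basis_vec i)) (\<rho> (basis_vec j))"
      using \<rho> by (simp add: lie_homs_Diff_def)
    hence "commutator (\<rho> (basis_vec i)) (\<rho> (basis_vec j)) f
        = \<rho> (scale_vec (of_int (i - j)) (basis_vec (i + j))) f"
      by (simp add: witt_bracket_def)
    also have "\<dots> = of_int (i - j) * \<rho> (basis_vec (i + j)) f"
      using \<rho> by (simp add: lie_homs_Diff_def fps_of_int del: of_int_diff)
    finally show "commutator (\<rho> (basis_vec i)) (\<rho> (basis_vec j)) f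
        = of_int (i - j) * \<rho> (basis_vec (i + j)) f" .
  qed (use \<rho> ord in \<open>auto simp: lie_homs_Diff_def\<close>)
  then obtain t where t: "t \<in> triples" and eq: "(\<lambda>i. \<rho> (basis_vec i)) = witt_op t"
    by (rule witt_family.witt_family_eq_witt_op)
  have "\<rho> = lin_ext (witt_op t)"
    by (rule trans[OF lie_hom_eq_lin_ext[OF \<rho>]]) (simp only: eq)
  with t show "\<exists>t\<in>triples. \<rho> = lin_ext (witt_op t)" by blast
qed

fun vir_op :: "complex fls \<times> complex fls \<times> complex \<Rightarrow> vir_basis \<Rightarrow> fps_op" where
  "vir_op t (L i) = witt_op t i"
| "vir_op t K = (\<lambda>f. 0)"

text \<open>
  As for the Witt algebra; in addition, for a given homomorphism, subtracting the known value of the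
  commutator of \<open>D\<^sub>2\<close> and \<open>D\<^sub>-\<^sub>2\<close> from the bracket relation leaves half the image of \<open>K\<close>, which is
  therefore 0.
\<close>

lemma vir_bij:
  "bij_betw (\<lambda>t. lin_ext (vir_op t)) triples
     {\<rho> \<in> lie_homs_Diff vir_bracket. has_order (\<rho> (basis_vec (L 0))) 1}"
proof (rule bij_betwI')
  fix t t' assume "t \<in> triples" "t' \<in> triples"
  thus "lin_ext (vir_op t) = lin_ext (vir_op t') \<longleftrightarrow> t = t'"
    by (metis lin_ext_basis vir_op.simps(1) witt_op_inject)
next
  fix t assume t: "t \<in> triples"
  have Diff: "vir_op t g \<in> Diff" for g
  proof (cases g)
    case K
    have "vir_op t g = op_of 0" by (simp add: K fun_eq_iff)
    thus ?thesis by (simp add: Diff_eq_range_op_of)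
  qed (use t in \<open>simp add: witt_op_in_Diff\<close>)
  have "lin_ext (vir_op t) (vir_bracket_basis g g') = commutator (vir_op t g) (vir_op t g')" for g g'
    using Diff_sum[OF witt_op_in_Diff[OF t], where A = "{}"]
    by (cases g; cases g')
       (auto simp: fun_eq_iff lin_ext_scale lin_ext_add witt_op_commutator[OF t] fps_of_int
          commutator_def[of _ "\<lambda>f. 0"] commutator_def[of "\<lambda>f. 0"] simp del: of_int_diff)
  thus "lin_ext (vir_op t) \<in> {\<rho> \<in> lie_homs_Diff vir_bracket. has_order (\<rho> (basis_vec (L 0))) 1}"
    using has_order_witt_op_0[OF t] Diff by (auto simp: vir_bracket_def intro!: lin_ext_in_lie_homs)
next
  fix \<rho> assume "\<rho> \<in> {\<rho> \<in> lie_homs_Diff vir_bracket. has_order (\<rho> (basis_vec (L 0))) 1}"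
  hence \<rho>: "\<rho> \<in> lie_homs_Diff vir_bracket" and ord: "has_order (\<rho> (basis_vec (L 0))) 1" by auto
  have br: "commutator (\<rho> (basis_vec (L i))) (\<rho> (basis_vec (L j))) f
      = of_int (i - j) * \<rho> (basis_vec (L (i + j))) f
        + fps_const (if i + j = 0 then of_int (i ^ 3 - i) / 12 else 0) * \<rho> (basis_vec K) f" for i j f
  proof -
    have "commutator (\<rho> (basis_vec (L i))) (\<rho> (basis_vec (L j))) f
        = \<rho> (vir_bracket (basis_vec (L i)) (basis_vec (L j))) f"
      using \<rho> by (simp add: lie_homs_Diff_def)
    also have "vir_bracket (basis_vec (L i)) (basis_vec (L j))
        = scale_vec (of_int (i - j)) (basis_vec (L (i + j)))
          + scale_vec (if i + j = 0 then of_int (i ^ 3 - i) / 12 else 0) (basis_vec K)"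
      unfolding vir_bracket_def bilinear_ext_basis by (rule vir_bracket_basis.simps)
    also have "\<rho> \<dots> f = fps_const (of_int (i - j)) * \<rho> (basis_vec (L (i + j))) f
        + fps_const (if i + j = 0 then of_int (i ^ 3 - i) / 12 else 0) * \<rho> (basis_vec K) f"
    proof -
      have "\<rho> (x + y) f = \<rho> x f + \<rho> y f" "\<rho> (scale_vec a x) f = fps_const a * \<rho> x f" for x y a
        using \<rho> by (simp_all add: lie_homs_Diff_def)
      thus ?thesis by (simp only:)
    qed
    finally show ?thesis unfolding fps_of_int .
  qed
  have "witt_family (\<lambda>i. \<rho> (basis_vec (L i)))"
  proof
    fix i j :: int and f
    assume "i + j \<noteq> 0 \<or> i ^ 3 = i"
    hence "(if i + j = 0 then of_int (i ^ 3 - i) / 12 else 0) = (0 :: complex)" by auto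
    thus "commutator (\<rho> (basis_vec (L i))) (\<rho> (basis_vec (L j))) f
        = of_int (i - j) * \<rho> (basis_vec (L (i + j))) f"
      unfolding br by simp
  qed (use \<rho> ord in \<open>auto simp: lie_homs_Diff_def\<close>)
  then obtain t where t: "t \<in> triples" and eq: "(\<lambda>i. \<rho> (basis_vec (L i))) = witt_op t"
    by (rule witt_family.witt_family_eq_witt_op)
  have L: "\<rho> (basis_vec (L i)) = witt_op t i" for i by (rule fun_cong[OF eq])
  have K: "\<rho> (basis_vec K) f = 0" for f
    using br[of 2 "-2" f] witt_op_commutator[OF t, of 2 "-2" f] by (simp add: L)
  have "\<rho> (basis_vec g) = vir_op t g" for g
    using L K by (cases g) (simp_all add: fun_eq_iff)
  hence "\<rho> = lin_ext (vir_op t)"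
    by (intro trans[OF lie_hom_eq_lin_ext[OF \<rho>]]) simp
  with t show "\<exists>t\<in>triples. \<rho> = lin_ext (vir_op t)" by blast
qed

theorem theorem4p10:
  shows
    "(\<exists>\<Phi>. bij_betw \<Phi> triples
            {\<rho> \<in> lie_homs_Diff witt_bracket. has_order (\<rho> (basis_vec 0)) 1}
        \<and> (\<forall>(h, b, c) \<in> triples. \<forall>i f.
              fps_to_fls (\<Phi> (h, b, c) (basis_vec i) f) = L_expr h b c i f))
   \<and> (\<exists>\<Phi>. bij_betw \<Phi> triples
            {\<rho> \<in> lie_homs_Diff vir_bracket. has_order (\<rho> (basis_vec (L 0))) 1}
        \<and> (\<forall>(h, b, c) \<in> triples.
              (\<forall>i f. fps_to_fls (\<Phi> (h, b, c) (basis_vec (L i)) f) = L_expr h b c i f)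
            \<and> (\<forall>f. \<Phi> (h, b, c) (basis_vec K) f = 0)))"
  using witt_bij vir_bij
  by (intro conjI exI[of _ "\<lambda>t. lin_ext (witt_op t)"] exI[of _ "\<lambda>t. lin_ext (vir_op t)"])
     (auto simp: witt_op_eq)

end
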